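(* Let $R$ be a commutative ring with unity with no nontrivial idempotents such that $\mathrm{Cl}(R)$ is not a complete graph. Then $\beta(\mathrm{Cl}(R)_{SR})=2$.
   Context: All rings are commutative with unity. $U(R)$ is the set of units, $\mathrm{Id}(R)$ the set of idempotents. The clean graph $\mathrm{Cl}(R)$ has vertex set $\{(e,u): e\in\mathrm{Id}(R), u\in U(R)\}$, two distinct vertices $(e,u),(f,v)$ being adjacent iff $ef=0$ or $uv=1$. In a connected graph $\Gamma$ with distance $d$ and neighbourhoods $N(x)$, $x$ is maximally distant from $y$ if $d(y,w)\le d(x,y)$ for all $w\in N(x)$, and $x,y$ are mutually maximally distant (MMD) if each is maximally distant from the other. The strong resolving graph $\Gamma_{SR}$ has as vertex set the vertices MMD with some vertex, two vertices adjacent iff MMD in $\Gamma$. $\beta$ denotes the independence number. *)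

theory Defs
  imports
    "HOL-Algebra.Ring"
    "HOL-Library.Extended_Nat"
    "Graph_Theory.Graph_Theory"
begin

text \<open>Undirected simple graphs are symmetric loop-free digraphs, as in the library; vertex sets
  may be infinite.\<close>

definition is_complete_graph :: "('a, 'b) pre_digraph \<Rightarrow> bool" where
  "is_complete_graph G \<longleftrightarrow>
     (\<forall>x \<in> verts G. \<forall>y \<in> verts G. x \<noteq> y \<longrightarrow> x \<rightarrow>\<^bsub>G\<^esub> y)"

text \<open>The length of a shortest walk, and \<open>\<infinity>\<close> if there is none.\<close>

definition graph_dist :: "('a, 'b) pre_digraph \<Rightarrow> 'a \<Rightarrow> 'a \<Rightarrow> ereal" where
  "graph_dist G = wf_digraph.\<mu> G (\<lambda>_. 1)"

definition neighbourhood :: "('a, 'b) pre_digraph \<Rightarrow> 'a \<Rightarrow> 'a set" where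
  "neighbourhood G x = {w. x \<rightarrow>\<^bsub>G\<^esub> w}"

definition maximally_distant :: "('a, 'b) pre_digraph \<Rightarrow> 'a \<Rightarrow> 'a \<Rightarrow> bool" where
  "maximally_distant G x y \<longleftrightarrow> (\<forall>w \<in> neighbourhood G x. graph_dist G y w \<le> graph_dist G x y)"

definition mutually_maximally_distant :: "('a, 'b) pre_digraph \<Rightarrow> 'a \<Rightarrow> 'a \<Rightarrow> bool" where
  "mutually_maximally_distant G x y \<longleftrightarrow> maximally_distant G x y \<and> maximally_distant G y x"

definition strong_resolving_graph :: "('a, 'b) pre_digraph \<Rightarrow> 'a pair_pre_digraph" where
  "strong_resolving_graph G =
     \<lparr> pverts = {x \<in> verts G. \<exists>y \<in> verts G. mutually_maximally_distant G x y},
       parcs = {(x, y). x \<in> verts G \<and> y \<in> verts G \<and> x \<noteq> y \<and> mutually_maximally_distant G x y} \<rparr>"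

definition independent_set :: "('a, 'b) pre_digraph \<Rightarrow> 'a set \<Rightarrow> bool" where
  "independent_set G S \<longleftrightarrow>
     S \<subseteq> verts G \<and> (\<forall>x \<in> S. \<forall>y \<in> S. x \<noteq> y \<longrightarrow> \<not> x \<rightarrow>\<^bsub>G\<^esub> y)"

text \<open>All infinite cardinalities are identified with \<open>\<infinity>\<close>; a finite value is the usual maximum.\<close>

definition independence_number :: "('a, 'b) pre_digraph \<Rightarrow> enat" where
  "independence_number G =
     (SUP S \<in> {S. independent_set G S}. if finite S then enat (card S) else \<infinity>)"

definition idempotents :: "('a, 'm) ring_scheme \<Rightarrow> 'a set" where
  "idempotents R = {e \<in> carrier R. e \<otimes>\<^bsub>R\<^esub> e = e}"

definition clean_graph :: "('a, 'm) ring_scheme \<Rightarrow> ('a \<times> 'a) pair_pre_digraph" where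
  "clean_graph R =
     \<lparr> pverts = idempotents R \<times> Units R,
       parcs = {((e, u), (f, v)).
         (e, u) \<in> idempotents R \<times> Units R \<and> (f, v) \<in> idempotents R \<times> Units R \<and>
         (e, u) \<noteq> (f, v) \<and> (e \<otimes>\<^bsub>R\<^esub> f = \<zero>\<^bsub>R\<^esub> \<or> u \<otimes>\<^bsub>R\<^esub> v = \<one>\<^bsub>R\<^esub>)} \<rparr>"

lemma (in cring) pair_bidirected_digraph_clean_graph: "pair_bidirected_digraph (clean_graph R)"
proof unfold_locales
  show "symmetric (with_proj (clean_graph R))"
    unfolding symmetric_def arcs_ends_def arc_to_ends_def clean_graph_def idempotents_def
    by (auto simp: sym_def image_iff m_comm Units_closed)
qed (auto simp: clean_graph_def)

lemma (in cring) strongly_connected_clean_graph: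
  "strongly_connected (with_proj (clean_graph R))"
proof -
  interpret G: pair_bidirected_digraph "clean_graph R"
    by (rule pair_bidirected_digraph_clean_graph)
  let ?G = "with_proj (clean_graph R)"
  let ?c = "(\<zero>, \<one>)"
  have c: "?c \<in> verts ?G"
    by (simp add: clean_graph_def idempotents_def)
  have to_c: "x \<rightarrow>\<^sup>*\<^bsub>?G\<^esub> ?c" if x: "x \<in> verts ?G" for x
  proof (cases "x = ?c")
    case True
    then show ?thesis using c by simp
  next
    case False
    then have "(x, ?c) \<in> parcs (clean_graph R)"
      using x c by (auto simp: clean_graph_def idempotents_def)
    then show ?thesis by (rule G.reachable_adjI)
  qed
  have "x \<rightarrow>\<^sup>*\<^bsub>?G\<^esub> y" if "x \<in> verts ?G" "y \<in> verts ?G" for x y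
    using to_c[OF that(1)] symmetric_reachable[OF G.sym_arcs to_c[OF that(2)]]
    by (rule G.reachable_trans)
  then show ?thesis
    using c unfolding strongly_connected_def by blast
qed

end

theory Submission
  imports Defs
begin

text \<open>The vertices \<open>(0, u)\<close> are adjacent to everything, so \<open>Cl(R)\<close> has diameter at most 2 and
  two distinct vertices are mutually maximally distant iff they are non-adjacent or twins. The
  vertices \<open>(0, u)\<close> are pairwise twins, and so are \<open>(1, u)\<close> and \<open>(1, u\<inverse>)\<close>, while all other pairs
  \<open>(1, u)\<close>, \<open>(1, v)\<close> are non-adjacent. If some \<open>(1, u)\<close> were adjacent to everything, then the only
  units would be \<open>u\<close> and \<open>u\<inverse>\<close> and the graph would be complete; hence no \<open>(0, u)\<close> is a twin of
  some \<open>(1, v)\<close>. So the strong resolving graph is a disjoint union of two cliques.\<close>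

text \<open>Distinct non-adjacent vertices are joined by a walk of two arcs through
  \<open>c\<close>, and every walk with at least two arcs costs at least 2.\<close>

lemma (in pair_wf_digraph) graph_dist_of_universal_vertex:
  assumes c: "\<And>z. z \<in> pverts G \<Longrightarrow> z \<noteq> c \<Longrightarrow> (z, c) \<in> parcs G \<and> (c, z) \<in> parcs G"
    and xy: "x \<in> pverts G" "y \<in> pverts G"
  shows "graph_dist (with_proj G) x y = (if x = y then 0 else if (x, y) \<in> parcs G then 1 else 2)"
proof -
  let ?d = "if x = y then 0 else if (x, y) \<in> parcs G then 1 else 2 :: real"
  have "\<exists>p. awalk x p y \<and> awalk_cost (\<lambda>_. 1) p = ?d"
  proof (cases "x = y \<or> (x, y) \<in> parcs G")
    case True
    then show ?thesis
      using xy by (intro exI[of _ "if x = y then [] else [(x, y)]"]) (auto simp: awalk_simps)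
  next
    case False
    \<comment> \<open>\<open>c\<close> is neither \<open>x\<close> nor \<open>y\<close>, since
      otherwise these two would be equal or adjacent.\<close>
    then have "(x, c) \<in> parcs G" "(c, y) \<in> parcs G"
      using c xy by blast+
    then show ?thesis
      using False xy by (intro exI[of _ "[(x, c), (c, y)]"]) (auto simp: awalk_simps)
  qed
  then obtain p where p: "awalk x p y" "awalk_cost (\<lambda>_. 1) p = ?d"
    by blast
  have lower: "?d \<le> awalk_cost (\<lambda>_. 1) q" if "awalk x q y" for q
  \<comment> \<open>The rule splits walks into those with no arc, one arc, and at least two
    arcs.\<close>
  proof (cases q rule: remdups_adj.cases)
    case (3 a b r)
    then have "awalk_cost (\<lambda>_. 1) r \<ge> 0"
      by (simp add: awalk_cost_def sum_list_triv)
    then show ?thesis using 3 by simp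
  qed (use that in \<open>auto simp: awalk_simps\<close>)
  have "\<mu> (\<lambda>_. 1) x y = ereal ?d"
    using min_cost_le_walk_cost[OF p(1), of "\<lambda>_. 1"] lower unfolding \<mu>_def p(2)
    by (intro antisym INF_greatest) auto
  then show ?thesis
    by (simp add: graph_dist_def zero_ereal_def one_ereal_def split: if_splits)
qed

text \<open>Distances are at most 2, so maximal distance is automatic for non-adjacent vertices. For
  adjacent ones it says that every further neighbour of the first is a neighbour of the second; the
  two directions together give twins.\<close>

lemma (in pair_bidirected_digraph) mutually_maximally_distant_iff_nonadjacent_or_twins:
  assumes c: "\<And>z. z \<in> pverts G \<Longrightarrow> z \<noteq> c \<Longrightarrow> (z, c) \<in> parcs G"
    and xy: "x \<in> pverts G" "y \<in> pverts G" "x \<noteq> y"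
  shows "mutually_maximally_distant (with_proj G) x y \<longleftrightarrow>
    (x, y) \<notin> parcs G \<or>
    (\<forall>w \<in> pverts G - {x, y}. (x, w) \<in> parcs G \<longleftrightarrow> (y, w) \<in> parcs G)"
proof -
  have sym: "(b, a) \<in> parcs G" if "(a, b) \<in> parcs G" for a b
    using that arcs_symmetric by blast
  have dist: "graph_dist (with_proj G) a b =
      (if a = b then 0 else if (a, b) \<in> parcs G then 1 else 2)"
    if "a \<in> pverts G" "b \<in> pverts G" for a b
    by (rule graph_dist_of_universal_vertex[of c]) (use c sym that in blast)+
  have md: "maximally_distant (with_proj G) a b \<longleftrightarrow>
      (a, b) \<notin> parcs G \<or> (\<forall>w \<in> pverts G - {a, b}. (a, w) \<in> parcs G \<longrightarrow> (b, w) \<in> parcs G)"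
    if ab: "a \<in> pverts G" "b \<in> pverts G" "a \<noteq> b" for a b
  proof -
    have "graph_dist (with_proj G) b w \<le> graph_dist (with_proj G) a b \<longleftrightarrow>
        (a, b) \<notin> parcs G \<or> w = b \<or> (b, w) \<in> parcs G" if "(a, w) \<in> parcs G" for w
      using ab that in_arcsD2[OF that] by (auto simp: dist)
    then show ?thesis
      using no_loops'[of a] in_arcsD2[of a]
      unfolding maximally_distant_def neighbourhood_def by auto
  qed
  show ?thesis
    unfolding mutually_maximally_distant_def
    using md[OF xy] md[of y x] xy sym by blast
qed

lemma independence_number_eqI:
  assumes "independent_set G S" "finite S" "card S = n"
    and "\<And>T. independent_set G T \<Longrightarrow> finite T \<and> card T \<le> n"
  shows "independence_number G = enat n"
  unfolding independence_number_def
proof (rule antisym)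
  show "(SUP S \<in> {S. independent_set G S}. if finite S then enat (card S) else \<infinity>) \<le> enat n"
    using assms(4) by (auto intro!: SUP_least)
  show "enat n \<le> (SUP S \<in> {S. independent_set G S}. if finite S then enat (card S) else \<infinity>)"
    using assms(1-3) by (intro SUP_upper2[of S]) auto
qed

lemma (in cring) mutually_maximally_distant_clean_graph_iff:
  assumes idem: "idempotents R = {\<zero>, \<one>}"
    and nc: "\<not> is_complete_graph (with_proj (clean_graph R))"
    and x: "e \<in> idempotents R" "u \<in> Units R"
    and y: "f \<in> idempotents R" "v \<in> Units R"
    and neq: "(e, u) \<noteq> (f, v)"
  shows "mutually_maximally_distant (with_proj (clean_graph R)) (e, u) (f, v) \<longleftrightarrow> e = f"
proof -
  interpret G: pair_bidirected_digraph "clean_graph R"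
    by (rule pair_bidirected_digraph_clean_graph)
  have verts: "pverts (clean_graph R) = {\<zero>, \<one>} \<times> Units R"
    by (simp add: clean_graph_def idem)
  have arc: "((a, s), (b, t)) \<in> parcs (clean_graph R) \<longleftrightarrow>
      (a, s) \<noteq> (b, t) \<and> (a = \<zero> \<or> b = \<zero> \<or> s \<otimes> t = \<one>)"
    if "a \<in> {\<zero>, \<one>}" "b \<in> {\<zero>, \<one>}" "s \<in> Units R" "t \<in> Units R" for a b s t
    using that by (auto simp: clean_graph_def idem)
  \<comment> \<open>A missing edge forces both first components to be \<open>\<one>\<close>, and its
    second components are \<open>s\<close> and \<open>t\<close>. If \<open>\<zero> = \<one>\<close>,
    all distinct vertices would be adjacent.\<close>
  obtain s t where st: "s \<in> Units R" "t \<in> Units R" "s \<noteq> t" "s \<otimes> t \<noteq> \<one>"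
    and nontriv: "\<zero> \<noteq> \<one>"
    using nc by (fastforce simp: is_complete_graph_def verts arc)
  \<comment> \<open>Otherwise \<open>a\<close> and \<open>inv a\<close> are the only units, so the
    distinct units \<open>s\<close> and \<open>t\<close> would be inverse to each other.\<close>
  have not_universal: "\<exists>w \<in> Units R. w \<noteq> a \<and> a \<otimes> w \<noteq> \<one>" if a: "a \<in> Units R" for a
  proof (rule ccontr)
    assume "\<not> ?thesis"
    then have "w = a \<or> a \<otimes> w = \<one>" if "w \<in> Units R" for w
      using that by blast
    then have "w = a \<or> w = inv a" if "w \<in> Units R" for w
      using that a by (metis Units_closed comm_inv_char)
    then show False
      using st a by (metis Units_l_inv Units_r_inv)
  qed
  \<comment> \<open>The separating vertex is \<open>(\<one>, w)\<close> with \<open>w\<close> from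
    \<open>not_universal\<close>: it is adjacent to \<open>(\<zero>, a)\<close> but not to
    \<open>(\<one>, b)\<close>.\<close>
  have mixed: "\<not> (\<forall>w \<in> pverts (clean_graph R) - {(\<zero>, a), (\<one>, b)}.
      ((\<zero>, a), w) \<in> parcs (clean_graph R) \<longleftrightarrow> ((\<one>, b), w) \<in> parcs (clean_graph R))"
    if ab: "a \<in> Units R" "b \<in> Units R" for a b
  proof -
    obtain w where "w \<in> Units R" "w \<noteq> b" "b \<otimes> w \<noteq> \<one>"
      using not_universal ab by blast
    then show ?thesis
      using ab nontriv by (intro notI, drule_tac bspec[of _ _ "(\<one>, w)"]) (auto simp: verts arc)
  qed
  \<comment> \<open>Both sides are false: the only inverse of \<open>a\<close> is \<open>b\<close>
    and conversely, and \<open>w\<close> is neither.\<close>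
  have inverse_twins: "a \<otimes> w = \<one> \<longleftrightarrow> b \<otimes> w = \<one>"
    if "a \<in> Units R" "b \<in> Units R" "w \<in> Units R" "a \<otimes> b = \<one>" "w \<noteq> a" "w \<noteq> b" for a b w
    using that by (metis Units_closed comm_inv_char m_comm)
  have mmd: "mutually_maximally_distant (with_proj (clean_graph R)) (e, u) (f, v) \<longleftrightarrow>
      ((e, u), (f, v)) \<notin> parcs (clean_graph R) \<or>
      (\<forall>w \<in> pverts (clean_graph R) - {(e, u), (f, v)}.
        ((e, u), w) \<in> parcs (clean_graph R) \<longleftrightarrow> ((f, v), w) \<in> parcs (clean_graph R))"
    by (rule G.mutually_maximally_distant_iff_nonadjacent_or_twins[of "(\<zero>, \<one>)"])
      (use x y neq in \<open>auto simp: verts arc idem\<close>)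
  consider "e = \<zero>" "f = \<zero>" | "e = \<one>" "f = \<one>" | "e = \<zero>" "f = \<one>" | "e = \<one>" "f = \<zero>"
    using x y idem by blast
  then show ?thesis
  proof cases
    case 1
    then show ?thesis using x y unfolding mmd by (auto simp: verts arc)
  next
    case 2
    have "((\<one>, u), w) \<in> parcs (clean_graph R) \<longleftrightarrow> ((\<one>, v), w) \<in> parcs (clean_graph R)"
      if "u \<otimes> v = \<one>" "w \<in> pverts (clean_graph R) - {(\<one>, u), (\<one>, v)}" for w
    proof -
      obtain a b where w: "w = (a, b)" "a \<in> {\<zero>, \<one>}" "b \<in> Units R"
        using \<open>w \<in> _\<close> verts by blast
      show ?thesis
      proof (cases "a = \<zero>")
        case True
        then show ?thesis using w x y nontriv by (simp add: arc)
      next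
        case False
        then have "a = \<one>" "b \<noteq> u" "b \<noteq> v"
          using w that by auto
        then show ?thesis
          using w x y nontriv inverse_twins[of u v b] \<open>u \<otimes> v = \<one>\<close> by (simp add: arc)
      qed
    qed
    moreover have "((\<one>, u), (\<one>, v)) \<in> parcs (clean_graph R) \<longleftrightarrow> u \<otimes> v = \<one>"
      using 2 x y neq nontriv by (simp add: arc)
    ultimately show ?thesis
      using 2 unfolding mmd by blast
  next
    case 3
    \<comment> \<open>The first components multiply to \<open>\<zero>\<close>, so the vertices are
      adjacent and only the twin alternative is left, which \<open>mixed\<close> refutes.\<close>
    then show ?thesis using x y nontriv mixed[of u v] unfolding mmd by (simp add: arc)
  next
    case 4
    then show ?thesis
      using x y nontriv mixed[of v u] unfolding mmd by (auto simp: arc insert_commute)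
  qed
qed

theorem theorem3p10:
  fixes R :: "('a, 'm) ring_scheme" (structure)
  assumes "cring R"
    and "idempotents R = {\<zero>, \<one>}"
    and "\<not> is_complete_graph (with_proj (clean_graph R))"
  shows "independence_number
           (with_proj (strong_resolving_graph (with_proj (clean_graph R)))) = 2"
proof -
  interpret cring R by fact
  let ?G = "with_proj (clean_graph R)"
  let ?SR = "with_proj (strong_resolving_graph ?G)"
  note mmd = mutually_maximally_distant_clean_graph_iff[OF assms(2,3)]
  have verts: "verts ?G = {\<zero>, \<one>} \<times> Units R"
    by (simp add: clean_graph_def assms(2))
  have arc: "x \<rightarrow>\<^bsub>?SR\<^esub> y \<longleftrightarrow> x \<in> verts ?G \<and> y \<in> verts ?G \<and> x \<noteq> y \<and> fst x = fst y" for x y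
    using mmd[of "fst x" "snd x" "fst y" "snd y"]
    by (auto simp: strong_resolving_graph_def clean_graph_def)
  obtain s t where st: "s \<in> Units R" "t \<in> Units R" "s \<noteq> t" and nontriv: "\<zero> \<noteq> \<one>"
    using assms(2,3) by (fastforce simp: is_complete_graph_def clean_graph_def)
  have verts_SR: "verts ?SR = verts ?G"
  proof -
    have "\<exists>y \<in> verts ?G. mutually_maximally_distant ?G x y" if x: "x \<in> verts ?G" for x
    proof -
      \<comment> \<open>Since there are two distinct units, every vertex has a partner with the same
        first component.\<close>
      obtain a where "a \<in> Units R" "a \<noteq> snd x"
        using st by metis
      then show ?thesis
        using x mmd[of "fst x" "snd x" "fst x" a]
        by (intro bexI[of _ "(fst x, a)"]) (auto simp: clean_graph_def)
    qed
    then show ?thesis by (auto simp: strong_resolving_graph_def)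
  qed
  have "independence_number ?SR = enat 2"
  \<comment> \<open>The witness takes one vertex from each clique.\<close>
  proof (rule independence_number_eqI[of _ "{(\<zero>, \<one>), (\<one>, \<one>)}"])
    show "independent_set ?SR {(\<zero>, \<one>), (\<one>, \<one>)}"
      using nontriv unfolding independent_set_def verts_SR arc verts by auto
    show "card {(\<zero>, \<one>), (\<one>, \<one>)} = 2"
      using nontriv by simp
    fix T
    assume T: "independent_set ?SR T"
    \<comment> \<open>An independent set meets each clique, that is each fibre of
      \<open>fst\<close>, at most once.\<close>
    then have inj: "inj_on fst T"
      unfolding independent_set_def verts_SR arc inj_on_def by blast
    have "fst ` T \<subseteq> {\<zero>, \<one>}"
      using T unfolding independent_set_def verts_SR verts by auto
    then have "finite (fst ` T)" "card (fst ` T) \<le> card {\<zero>, \<one>}"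
      by (auto intro: finite_subset card_mono)
    then show "finite T \<and> card T \<le> 2"
      using nontriv inj by (simp add: card_image finite_image_iff)
  qed simp
  then show ?thesis by (simp add: numeral_eq_enat)
qed

end
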